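(* Let $n\geq 2$ be an integer. Then for every integer $k > (n-1)^2+1$, $$a^a_n(k) = 2a^a_n(k-1)-a^a_n(k-2) + \left\lfloor \frac{(n-1)^2}{2}\right\rfloor .$$
   Context: For integers $n\geq 1$ and $k\geq 0$, the $n$ by $k$ grid is the set of points $\{1,\dots,n\}\times\{1,\dots,k\}\subset\mathbb{R}^2$ (empty if $k=0$). $a^a_n(k)$ denotes the number of acute isosceles triangles of nonzero area formed by 3 distinct points of the $n$ by $k$ grid, i.e. the number of 3-element non-collinear subsets of the grid that are the vertices of a triangle with at least two sides of equal Euclidean length and with all angles strictly less than $90^\circ$. *)

theory Defs
  imports "HOL-Analysis.Analysis"
begin

definition grid :: "nat \<Rightarrow> nat \<Rightarrow> (real \<times> real) set" where
  "grid n k = (\<lambda>(i, j). (real i, real j)) ` ({1..n} \<times> {1..k})"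

(* The unoriented angle at b between the rays towards a and c, in [0, pi];
   only used for a and c different from b. *)
definition angle_at :: "'a::real_inner \<Rightarrow> 'a \<Rightarrow> 'a \<Rightarrow> real" where
  "angle_at a b c = arccos (((a - b) \<bullet> (c - b)) / (norm (a - b) * norm (c - b)))"

(* A triangle is represented by its vertex set. *)
definition is_triangle :: "(real \<times> real) set \<Rightarrow> bool" where
  "is_triangle T \<longleftrightarrow> card T = 3 \<and> \<not> collinear T"

definition isosceles :: "(real \<times> real) set \<Rightarrow> bool" where
  "isosceles T \<longleftrightarrow> is_triangle T \<and> (\<exists>a b c. T = {a, b, c} \<and> dist a b = dist a c)"

definition acute :: "(real \<times> real) set \<Rightarrow> bool" where
  "acute T \<longleftrightarrow> is_triangle T \<and> (\<forall>a b c. T = {a, b, c} \<longrightarrow> angle_at a b c < pi / 2)"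

definition acute_isosceles_count :: "nat \<Rightarrow> nat \<Rightarrow> nat" where
  "acute_isosceles_count n k = card {T. T \<subseteq> grid n k \<and> isosceles T \<and> acute T}"

end

theory Submission
  imports Defs
begin

text \<open>
  Write \<open>A k\<close> for the set of acute isosceles triangles in the \<open>n\<close> by \<open>k\<close> grid. The grid
  with \<open>k\<close> rows contains two copies of the grid with \<open>k - 1\<close> rows: the lower one, and its upward
  translate by one row. They overlap in a copy of the grid with \<open>k - 2\<close> rows. By
  inclusion-exclusion, \<open>A k\<close> has \<open>2 * card (A (k - 1)) - card (A (k - 2))\<close> members that fit
  into one of the two copies, and the recurrence reduces to counting the spanning triangles, those
  that meet both the bottom row and the top row (\<open>card_grid_triangles_recurrence\<close>).

  Let \<open>H = k - 1 > (n - 1)^2\<close> be the height of the grid. Each horizontal distance is at most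
  \<open>n - 1\<close>, so two squared horizontal distances differ by less than \<open>H\<close>. Equality of the legs of an
  isosceles triangle balances such a difference against a difference of squares of two vertical
  distances, and for a spanning triangle the latter is zero or at least \<open>H\<close> in absolute value.
  So it is zero: if one leg is \<open>(x, y)\<close>, seen from the apex, then the other one is
  \<open>(\<plusminus>x, \<plusminus>y)\<close>, and the triangle has a vertical or a horizontal axis of symmetry. In
  the latter case it is tall only because its base is, and its apex angle is acute only if its
  width exceeds \<open>H / 2\<close>, which contradicts \<open>2 * (n - 1) \<le> (n - 1)^2 + 1 \<le> H\<close>. This leaves the
  triangles with a horizontal base in one extreme row and the apex above or below its midpoint in
  the other (\<open>tall_spanning_triangle\<close>).

  Such a triangle is given by the choice of the base row, the half-width \<open>w\<close> of the base and the
  column \<open>c\<close> of the apex, where \<open>w < c \<le> n - w\<close>. For each \<open>w\<close> there are \<open>n - 2 * w\<close> columns, and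
  twice the sum of these numbers is \<open>\<lfloor>(n - 1)^2 / 2\<rfloor>\<close>.
\<close>

section \<open>Acute isosceles triangles and their translates\<close>

lemma angle_at_less_pi_half_iff:
  fixes a b c :: "'a::real_inner"
  assumes "a \<noteq> b" "c \<noteq> b"
  shows "angle_at a b c < pi / 2 \<longleftrightarrow> (a - b) \<bullet> (c - b) > 0"
proof -
  let ?N = "norm (a - b) * norm (c - b)"
  let ?t = "((a - b) \<bullet> (c - b)) / ?N"
  have N: "?N > 0" using assms by simp
  have "\<bar>?t\<bar> \<le> 1"
    using Cauchy_Schwarz_ineq2[of "a - b" "c - b"] N by (simp add: abs_mult divide_le_eq_1)
  then have "arccos ?t < arccos 0 \<longleftrightarrow> 0 < ?t"
    by (intro arccos_less_mono) auto
  then show ?thesis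
    unfolding angle_at_def using N by (simp add: zero_less_divide_iff)
qed

lemma not_collinear_if_equal_legs:
  fixes a b c :: "'a::real_inner"
  assumes "b \<noteq> c" "dist a b = dist a c" "(b - a) \<bullet> (c - a) > 0"
  shows "\<not> collinear {a, b, c}"
proof
  assume "collinear {a, b, c}"
  then have "collinear {b, a, c}" by (simp add: insert_commute)
  then have "collinear {0, b - a, c - a}" by (simp add: collinear_3)
  moreover have nz: "b - a \<noteq> 0" "c - a \<noteq> 0" using assms(3) by auto
  ultimately obtain r where r: "c - a = r *\<^sub>R (b - a)"
    unfolding collinear_lemma by blast
  have "norm (c - a) = norm (b - a)" using assms(2) by (simp add: dist_norm norm_minus_commute)
  then have "\<bar>r\<bar> = 1" using r nz by simp
  moreover have "r > 0"
    using assms(3) inner_ge_zero[of "b - a"] unfolding r inner_scaleR_right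
    by (simp only: zero_less_mult_iff) linarith
  ultimately have "r = 1" by simp
  then show False using r assms(1) by simp
qed

text \<open>
  Only the angle at the apex needs checking: the inner product that measures a base angle is half
  the squared length of the base. A positive inner product at the apex also separates the apex
  from the base vertices and, with legs of equal length, excludes a flat triangle.
\<close>

lemma acute_isoscelesI:
  assumes bc: "b \<noteq> c" and d: "dist a b = dist a c" and p: "(b - a) \<bullet> (c - a) > 0"
  shows "isosceles {a, b, c} \<and> acute {a, b, c}"
proof -
  have ne: "a \<noteq> b" "a \<noteq> c" using p by auto
  have tri: "is_triangle {a, b, c}"
    using not_collinear_if_equal_legs[OF bc d p] ne bc unfolding is_triangle_def by simp
  have eq: "(b - a) \<bullet> (b - a) = (c - a) \<bullet> (c - a)"
    using d by (metis dist_commute dist_norm dot_square_norm)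
  have base: "(c - b) \<bullet> (c - b) > 0" using bc by simp
  have pb: "(a - b) \<bullet> (c - b) > 0" and pc: "(a - c) \<bullet> (b - c) > 0"
    using eq base by (simp_all only: inner_diff_left inner_diff_right inner_commute)
  have "angle_at x y z < pi / 2" if "{a, b, c} = {x, y, z}" for x y z
  proof -
    have "card {x, y, z} = 3" using tri unfolding is_triangle_def that by simp
    then have distinct: "x \<noteq> y" "z \<noteq> y" "x \<noteq> z"
      by (auto simp: card_insert_if split: if_splits)
    have "x \<in> {a, b, c}" "y \<in> {a, b, c}" "z \<in> {a, b, c}" using that by simp_all
    then have "(x - y) \<bullet> (z - y) > 0"
      using distinct p pb pc p[unfolded inner_commute[of "b - a"]]
        pb[unfolded inner_commute[of "a - b"]] pc[unfolded inner_commute[of "a - c"]]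
      by (elim insertE emptyE) blast+
    then show ?thesis using angle_at_less_pi_half_iff distinct by blast
  qed
  then have "acute {a, b, c}" using tri unfolding acute_def by (intro conjI allI impI)
  moreover have "isosceles {a, b, c}"
    unfolding isosceles_def using tri d by (intro conjI exI[of _ a] exI[of _ b] exI[of _ c] refl)
  ultimately show ?thesis by (intro conjI)
qed

lemma acute_isoscelesE:
  assumes "isosceles T \<and> acute T"
  obtains a b c where
    "T = {a, b, c}" "b \<noteq> c" "dist a b = dist a c" "(b - a) \<bullet> (c - a) > 0"
proof -
  have card: "card T = 3" and angles: "\<forall>x y z. T = {x, y, z} \<longrightarrow> angle_at x y z < pi / 2"
    using assms unfolding acute_def is_triangle_def by (iprover)+
  obtain a b c where T: "T = {a, b, c}" "dist a b = dist a c"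
    using assms unfolding isosceles_def by (elim conjE exE)
  have ne: "a \<noteq> b" "a \<noteq> c" "b \<noteq> c"
    using card unfolding T by (auto simp: card_insert_if split: if_splits)
  have "T = {b, a, c}" unfolding T by (rule insert_commute)
  then have "angle_at b a c < pi / 2" by (rule angles[rule_format])
  then have "(b - a) \<bullet> (c - a) > 0" using angle_at_less_pi_half_iff ne by metis
  with T ne show ?thesis by (intro that)
qed

lemma acute_isosceles_translate:
  fixes v :: "real \<times> real"
  assumes "isosceles T \<and> acute T"
  shows "isosceles ((+) v ` T) \<and> acute ((+) v ` T)"
proof -
  obtain a b c where T: "T = {a, b, c}" "b \<noteq> c" "dist a b = dist a c" "(b - a) \<bullet> (c - a) > 0"
    using assms by (rule acute_isoscelesE)
  have "isosceles {v + a, v + b, v + c} \<and> acute {v + a, v + b, v + c}"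
    by (rule acute_isoscelesI) (use T in \<open>simp_all add: dist_norm\<close>)
  then show ?thesis using T(1) by simp
qed

section \<open>Inclusion-exclusion over two translated grids\<close>

definition grid_triangles :: "nat \<Rightarrow> nat \<Rightarrow> (real \<times> real) set set" where
  "grid_triangles n k = {T. T \<subseteq> grid n k \<and> isosceles T \<and> acute T}"

definition shift_up :: "(real \<times> real) set \<Rightarrow> (real \<times> real) set" where
  "shift_up T = (+) (0, 1) ` T"

definition spanning_triangles :: "nat \<Rightarrow> nat \<Rightarrow> (real \<times> real) set set" where
  "spanning_triangles n k =
    {T \<in> grid_triangles n k. (\<exists>p\<in>T. snd p = 1) \<and> (\<exists>p\<in>T. snd p = real k)}"

lemma mem_grid_iff:
  "p \<in> grid n k \<longleftrightarrow> (\<exists>i j. p = (real i, real j) \<and> 1 \<le> i \<and> i \<le> n \<and> 1 \<le> j \<and> j \<le> k)"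
  unfolding grid_def by auto

lemma lattice_point_mem_grid_iff:
  "(real i, real j) \<in> grid n k \<longleftrightarrow> 1 \<le> i \<and> i \<le> n \<and> 1 \<le> j \<and> j \<le> k"
  by (auto simp: mem_grid_iff)

lemma finite_grid_triangles: "finite (grid_triangles n k)"
proof -
  have "finite (Pow (grid n k))" unfolding grid_def by simp
  moreover have "grid_triangles n k \<subseteq> Pow (grid n k)" unfolding grid_triangles_def by blast
  ultimately show ?thesis by (rule finite_subset[rotated])
qed

lemma inj_shift_up: "inj shift_up"
  unfolding shift_up_def by (intro injI) (simp add: inj_image_eq_iff)

lemma grid_mono_Suc: "grid n k \<subseteq> grid n (Suc k)"
  by (force simp: mem_grid_iff)

lemma mem_grid_drop_top_row:
  assumes "p \<in> grid n (Suc k)" "snd p \<noteq> real (Suc k)"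
  shows "p \<in> grid n k"
  using assms by (auto simp: mem_grid_iff le_Suc_eq)

lemma mem_grid_drop_bottom_row:
  assumes "p \<in> grid n (Suc k)" "snd p \<noteq> 1"
  shows "(0, -1) + p \<in> grid n k"
proof -
  obtain i j where ij: "p = (real i, real j)" "1 \<le> i" "i \<le> n" "1 \<le> j" "j \<le> Suc k"
    using assms by (auto simp: mem_grid_iff)
  moreover have "j \<noteq> 1" using assms ij by auto
  ultimately have "(0, -1) + p = (real i, real (j - 1)) \<and> 1 \<le> j - 1 \<and> j - 1 \<le> k"
    by auto
  with ij show ?thesis unfolding mem_grid_iff by blast
qed

lemma mem_grid_shift_up:
  assumes "p \<in> grid n k"
  shows "(0, 1) + p \<in> grid n (Suc k)"
proof -
  obtain i j where ij: "p = (real i, real j)" "1 \<le> i" "i \<le> n" "1 \<le> j" "j \<le> k"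
    using assms by (auto simp: mem_grid_iff)
  then have "(0, 1) + p = (real i, real (Suc j)) \<and> 1 \<le> Suc j \<and> Suc j \<le> Suc k" by simp
  with ij show ?thesis unfolding mem_grid_iff by blast
qed

lemma shift_up_grid_triangles:
  "shift_up T \<in> grid_triangles n (Suc k)" if "T \<in> grid_triangles n k"
  using that mem_grid_shift_up acute_isosceles_translate
  unfolding grid_triangles_def shift_up_def by blast

lemma shift_up_preimage:
  assumes T: "T \<in> grid_triangles n (Suc k)" and no_bottom: "\<forall>p\<in>T. snd p \<noteq> 1"
  shows "T \<in> shift_up ` grid_triangles n k"
proof
  let ?T' = "(+) (0, -1) ` T"
  show "T = shift_up ?T'"
    unfolding shift_up_def by (simp add: image_image flip: add.assoc zero_prod_def)
  show "?T' \<in> grid_triangles n k"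
    using T no_bottom mem_grid_drop_bottom_row acute_isosceles_translate
    unfolding grid_triangles_def by blast
qed

text \<open>
  The overlap of the two copies: the members of both avoid the bottom row and the top row.
\<close>

lemma grid_triangles_Int_shift:
  "grid_triangles n (Suc j) \<inter> shift_up ` grid_triangles n (Suc j) = shift_up ` grid_triangles n j"
proof (intro equalityI subsetI)
  fix T assume "T \<in> grid_triangles n (Suc j) \<inter> shift_up ` grid_triangles n (Suc j)"
  then obtain T' where T: "T \<in> grid_triangles n (Suc j)"
    and T': "T' \<in> grid_triangles n (Suc j)" "T = shift_up T'" by blast
  have "p \<in> grid n j" if "p \<in> T'" for p
  proof (rule mem_grid_drop_top_row)
    show "p \<in> grid n (Suc j)" using that T' unfolding grid_triangles_def by blast
    have "(0, 1) + p \<in> grid n (Suc j)"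
      using that T T' unfolding grid_triangles_def shift_up_def by blast
    then show "snd p \<noteq> real (Suc j)"
      unfolding mem_grid_iff by (cases p) auto
  qed
  then show "T \<in> shift_up ` grid_triangles n j"
    using T' unfolding grid_triangles_def by blast
next
  fix T assume "T \<in> shift_up ` grid_triangles n j"
  then obtain T' where T': "T' \<in> grid_triangles n j" "T = shift_up T'" by blast
  have "T' \<in> grid_triangles n (Suc j)"
    using T'(1) grid_mono_Suc unfolding grid_triangles_def by blast
  then show "T \<in> grid_triangles n (Suc j) \<inter> shift_up ` grid_triangles n (Suc j)"
    using T' shift_up_grid_triangles by blast
qed

lemma grid_triangles_decompose:
  "grid_triangles n (Suc k) =
    (grid_triangles n k \<union> shift_up ` grid_triangles n k) \<union> spanning_triangles n (Suc k)"
proof (intro equalityI subsetI)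
  fix T assume T: "T \<in> grid_triangles n (Suc k)"
  show "T \<in> (grid_triangles n k \<union> shift_up ` grid_triangles n k) \<union> spanning_triangles n (Suc k)"
  proof (cases "T \<in> spanning_triangles n (Suc k)")
    case False
    then consider "\<forall>p\<in>T. snd p \<noteq> 1" | "\<forall>p\<in>T. snd p \<noteq> real (Suc k)"
      using T unfolding spanning_triangles_def by blast
    then show ?thesis
    proof cases
      case 1
      then show ?thesis using shift_up_preimage T by blast
    next
      case 2
      then have "T \<in> grid_triangles n k"
        using T mem_grid_drop_top_row unfolding grid_triangles_def by blast
      then show ?thesis by blast
    qed
  qed blast
next
  fix T
  assume "T \<in> (grid_triangles n k \<union> shift_up ` grid_triangles n k) \<union> spanning_triangles n (Suc k)"
  then consider "T \<in> grid_triangles n k" | "T \<in> shift_up ` grid_triangles n k"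
    | "T \<in> spanning_triangles n (Suc k)" by blast
  then show "T \<in> grid_triangles n (Suc k)"
  proof cases
    case 1
    then show ?thesis using grid_mono_Suc unfolding grid_triangles_def by auto
  next
    case 2
    then show ?thesis using shift_up_grid_triangles by auto
  next
    case 3
    then show ?thesis unfolding spanning_triangles_def by simp
  qed
qed

lemma spanning_triangles_disjoint:
  "(grid_triangles n k \<union> shift_up ` grid_triangles n k) \<inter> spanning_triangles n (Suc k) = {}"
proof -
  have "T \<notin> spanning_triangles n (Suc k)" if "T \<in> grid_triangles n k" for T
    using that unfolding grid_triangles_def spanning_triangles_def by (force simp: mem_grid_iff)
  moreover have "shift_up T \<notin> spanning_triangles n (Suc k)" if "T \<in> grid_triangles n k" for T
  proof -
    have "snd p \<noteq> 1" if p: "p \<in> shift_up T" for p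
    proof -
      obtain q where "q \<in> grid n k" "p = (0, 1) + q"
        using p \<open>T \<in> grid_triangles n k\<close> unfolding grid_triangles_def shift_up_def by auto
      then show ?thesis by (auto simp: mem_grid_iff)
    qed
    then show ?thesis unfolding spanning_triangles_def by auto
  qed
  ultimately show ?thesis by auto
qed

lemma card_grid_triangles_recurrence:
  "card (grid_triangles n (Suc (Suc j))) + card (grid_triangles n j) =
    2 * card (grid_triangles n (Suc j)) + card (spanning_triangles n (Suc (Suc j)))"
proof -
  let ?A = "grid_triangles n (Suc j)" and ?S = "spanning_triangles n (Suc (Suc j))"
  have card_shift: "card (shift_up ` X) = card X" for X
    by (intro card_image inj_on_subset[OF inj_shift_up]) simp
  have finS: "finite ?S"
    unfolding spanning_triangles_def using finite_grid_triangles by simp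
  have finA: "finite ?A" "finite (shift_up ` ?A)" using finite_grid_triangles by simp_all
  have "card (grid_triangles n (Suc (Suc j))) = card (?A \<union> shift_up ` ?A) + card ?S"
    unfolding grid_triangles_decompose[of n "Suc j"]
    by (intro card_Un_disjoint finite_UnI finA finS spanning_triangles_disjoint)
  moreover have "card ?A + card (shift_up ` ?A) =
      card (?A \<union> shift_up ` ?A) + card (shift_up ` grid_triangles n j)"
    unfolding card_Un_Int[OF finA] grid_triangles_Int_shift ..
  ultimately show ?thesis unfolding card_shift by linarith
qed

section \<open>Spanning triangles of a tall grid\<close>

text \<open>
  Here \<open>u\<close> and \<open>v\<close> are the vectors from the apex to the two base vertices, \<open>m\<close> bounds the width
  and \<open>H\<close> is the height of the bounding box. Since the height is attained, it is the height of
  a leg or of the base. In the first case a second leg of smaller height could only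
  catch up by a width of more than \<open>m\<close>. In the second case the legs balance only if the apex is
  at half height; then an acute apex angle needs a width of more than \<open>H / 2\<close>, whereas
  \<open>2 * m \<le> m\<^sup>2 + 1 \<le> H\<close>.
\<close>

lemma tall_spanning_triangle:
  fixes u1 u2 v1 v2 m H :: int
  assumes tall: "m\<^sup>2 < H"
    and width: "\<bar>u1\<bar> \<le> m" "\<bar>v1\<bar> \<le> m"
    and height: "\<bar>u2\<bar> \<le> H" "\<bar>v2\<bar> \<le> H" "\<bar>u2 - v2\<bar> \<le> H"
    and spanning: "\<bar>u2\<bar> = H \<or> \<bar>v2\<bar> = H \<or> \<bar>u2 - v2\<bar> = H"
    and base: "(u1, u2) \<noteq> (v1, v2)"
    and legs: "u1\<^sup>2 + u2\<^sup>2 = v1\<^sup>2 + v2\<^sup>2"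
    and acute: "u1 * v1 + u2 * v2 > 0"
  shows "v2 = u2 \<and> \<bar>u2\<bar> = H \<and> v1 = - u1"
proof -
  have sq: "u1\<^sup>2 \<le> m\<^sup>2" "v1\<^sup>2 \<le> m\<^sup>2" using width by (simp_all add: abs_le_square_iff[symmetric])
  have Hpos: "H > 0" using tall by (smt (verit) zero_le_power2)
  \<comment> \<open>The next smaller square after \<open>H\<^sup>2\<close> is less by \<open>2 * H - 1\<close>, which is more than \<open>m\<^sup>2\<close>.\<close>
  have full: "\<bar>y\<bar> = H" if "\<bar>x\<bar> = H" "\<bar>y\<bar> \<le> H" "x\<^sup>2 - y\<^sup>2 \<le> m\<^sup>2" for x y :: int
  proof (rule ccontr)
    assume "\<bar>y\<bar> \<noteq> H"
    then have "\<bar>y\<bar> \<le> H - 1" using that by simp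
    then have "\<bar>y\<bar>\<^sup>2 \<le> (H - 1)\<^sup>2" by (intro power_mono) auto
    moreover have "x\<^sup>2 = H\<^sup>2" using that(1) by (metis power2_abs)
    ultimately have "2 * H - 1 \<le> m\<^sup>2" using that(3) by (simp add: power2_eq_square algebra_simps)
    then show False using tall Hpos by linarith
  qed
  show ?thesis
  proof (cases "\<bar>u2\<bar> = H \<or> \<bar>v2\<bar> = H")
    case True
    have "u2\<^sup>2 - v2\<^sup>2 \<le> m\<^sup>2" "v2\<^sup>2 - u2\<^sup>2 \<le> m\<^sup>2"
      using legs sq zero_le_power2[of u1] zero_le_power2[of v1] by linarith+
    then have "\<bar>u2\<bar> = H" "\<bar>v2\<bar> = H" using True full height by blast+
    then have "v2 = u2" "\<bar>u2\<bar> = H" using height(3) Hpos by linarith+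
    moreover have "u1\<^sup>2 = v1\<^sup>2" using legs \<open>v2 = u2\<close> by simp
    moreover have "u1 \<noteq> v1" using base \<open>v2 = u2\<close> by simp
    ultimately show ?thesis by (auto simp: power2_eq_iff)
  next
    case False
    then have D: "\<bar>u2 - v2\<bar> = H" using spanning by blast
    have "v1\<^sup>2 - u1\<^sup>2 = (u2 - v2) * (u2 + v2)"
      using legs by (simp add: power2_eq_square algebra_simps)
    then have "\<bar>v1\<^sup>2 - u1\<^sup>2\<bar> = H * \<bar>u2 + v2\<bar>" using D by (simp add: abs_mult)
    moreover have "\<bar>v1\<^sup>2 - u1\<^sup>2\<bar> < H"
      using sq tall zero_le_power2[of u1] zero_le_power2[of v1] by linarith
    ultimately have "H * \<bar>u2 + v2\<bar> < H * 1" by simp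
    then have "\<bar>u2 + v2\<bar> < 1" using Hpos by (simp only: mult_less_cancel_left_pos)
    then have v2: "v2 = - u2" by linarith
    then have H: "H = 2 * \<bar>u2\<bar>" using D by simp
    have "\<bar>u1\<bar> = \<bar>v1\<bar>" using legs v2 by (simp add: power2_eq_iff abs_eq_iff)
    then have "u1 * v1 \<le> \<bar>u1\<bar>\<^sup>2"
      by (metis abs_ge_self abs_mult power2_eq_square)
    then have "\<bar>u2\<bar>\<^sup>2 < \<bar>u1\<bar>\<^sup>2" using acute v2 by (simp add: power2_eq_square)
    then have "\<bar>u2\<bar> < \<bar>u1\<bar>" by (rule power_less_imp_less_base) simp
    then have "m\<^sup>2 + 1 \<le> 2 * m - 2" using width H tall by linarith
    moreover have "(m - 1)\<^sup>2 \<ge> 0" by simp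
    ultimately have False by (simp add: power2_eq_square algebra_simps)
    then show ?thesis ..
  qed
qed

definition upright_triangle :: "real \<Rightarrow> real \<Rightarrow> nat \<times> nat \<Rightarrow> (real \<times> real) set" where
  "upright_triangle base_row apex_row = (\<lambda>(w, c).
    {(real c, apex_row), (real c - real w, base_row), (real c + real w, base_row)})"

text \<open>
  The pairs of the half-width of a horizontal base and the column of its midpoint. In a symmetric
  triangle this column is that of the apex, which is why the midpoint is a grid column.
\<close>

definition bases :: "nat \<Rightarrow> (nat \<times> nat) set" where
  "bases n = (SIGMA w:{1..(n - 1) div 2}. {w<..n - w})"

lemma mem_bases_iff: "(w, c) \<in> bases n \<longleftrightarrow> 1 \<le> w \<and> w < c \<and> c + w \<le> n"
  unfolding bases_def by auto

text \<open>
  The apex is the only vertex in its row, which gives \<open>c\<close>; the right end of the base then gives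
  \<open>w\<close>, because half-widths are positive.
\<close>

lemma inj_upright_triangle:
  assumes "b \<noteq> t"
  shows "inj_on (upright_triangle b t) (bases n)"
proof (intro inj_onI, clarify)
  fix w c w' c'
  assume *: "(w, c) \<in> bases n" "(w', c') \<in> bases n"
    and eq: "upright_triangle b t (w, c) = upright_triangle b t (w', c')"
  have "(real c, t) \<in> upright_triangle b t (w', c')"
    and "(real c + real w, b) \<in> upright_triangle b t (w', c')"
    unfolding eq[symmetric] by (simp_all add: upright_triangle_def)
  then show "w = w' \<and> c = c'"
    using assms * by (auto simp: upright_triangle_def mem_bases_iff)
qed

lemma upright_triangles_disjoint:
  assumes "b \<noteq> t"
  shows "upright_triangle b t ` bases n \<inter> upright_triangle t b ` bases n = {}"
proof -
  have False if *: "(w, c) \<in> bases n"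
    and eq: "upright_triangle b t (w, c) = upright_triangle t b (w', c')" for w c w' c'
  proof -
    have "(real c - real w, b) \<in> upright_triangle t b (w', c')"
      and "(real c + real w, b) \<in> upright_triangle t b (w', c')"
      unfolding eq[symmetric] by (simp_all add: upright_triangle_def)
    then show False using assms * by (auto simp: upright_triangle_def mem_bases_iff)
  qed
  then show ?thesis by fast
qed

lemma upright_triangle_spanning:
  assumes wc: "(w, c) \<in> bases n" and k: "n \<le> k"
    and rows: "b = 1 \<and> t = k \<or> b = k \<and> t = 1"
  shows "upright_triangle (real b) (real t) (w, c) \<in> spanning_triangles n k"
proof -
  have w: "1 \<le> w" "w < c" "c + w \<le> n" using wc by (simp_all add: mem_bases_iff)
  let ?a = "(real c, real t)" and ?p = "(real c - real w, real b)" and ?q = "(real c + real w, real b)"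
  have T: "upright_triangle (real b) (real t) (w, c) = {?a, ?p, ?q}"
    by (simp add: upright_triangle_def)
  have rows': "1 \<le> b" "b \<le> k" "1 \<le> t" "t \<le> k" using rows w k by auto
  have p: "?p = (real (c - w), real b)" and q: "?q = (real (c + w), real b)"
    using w by simp_all
  have "{?a, ?p, ?q} \<subseteq> grid n k"
    unfolding p q insert_subset lattice_point_mem_grid_iff using w rows' by auto
  moreover have "isosceles {?a, ?p, ?q} \<and> acute {?a, ?p, ?q}"
  proof -
    have "real w < real k - 1" using w k by linarith
    then have "(real w)\<^sup>2 < (real k - 1)\<^sup>2" by (intro power_strict_mono) auto
    moreover have "(real b - real t)\<^sup>2 = (real k - 1)\<^sup>2" using rows by (auto simp: power2_commute)
    ultimately have "(?p - ?a) \<bullet> (?q - ?a) > 0"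
      by (simp add: power2_eq_square)
    moreover have "?p \<noteq> ?q" using w by simp
    moreover have "dist ?a ?p = dist ?a ?q" by (simp add: dist_Pair_Pair dist_real_def)
    ultimately show ?thesis by (intro acute_isoscelesI)
  qed
  ultimately show ?thesis
    unfolding spanning_triangles_def grid_triangles_def T using rows by auto
qed

lemma spanning_triangle_upright:
  assumes k: "k > (n - 1)\<^sup>2 + 1" and T: "T \<in> spanning_triangles n k"
  shows "T \<in> upright_triangle 1 (real k) ` bases n \<union> upright_triangle (real k) 1 ` bases n"
proof -
  have sub: "T \<subseteq> grid n k" and bot: "\<exists>p\<in>T. snd p = 1" and top: "\<exists>p\<in>T. snd p = real k"
    and "isosceles T \<and> acute T"
    using T unfolding spanning_triangles_def grid_triangles_def by auto
  then obtain a b c where abc: "T = {a, b, c}" "b \<noteq> c" "dist a b = dist a c"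
    "(b - a) \<bullet> (c - a) > 0"
    using acute_isoscelesE by metis
  obtain a1 a2 where a: "a = (real a1, real a2)" "1 \<le> a1" "a1 \<le> n" "1 \<le> a2" "a2 \<le> k"
    using sub abc(1) by (auto simp: mem_grid_iff)
  obtain b1 b2 where b: "b = (real b1, real b2)" "1 \<le> b1" "b1 \<le> n" "1 \<le> b2" "b2 \<le> k"
    using sub abc(1) by (auto simp: mem_grid_iff)
  obtain c1 c2 where c: "c = (real c1, real c2)" "1 \<le> c1" "c1 \<le> n" "1 \<le> c2" "c2 \<le> k"
    using sub abc(1) by (auto simp: mem_grid_iff)
  have rows: "a2 = 1 \<or> b2 = 1 \<or> c2 = 1" "a2 = k \<or> b2 = k \<or> c2 = k"
    using bot top unfolding abc(1) a(1) b(1) c(1) by auto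
  define u1 u2 v1 v2 where uv: "u1 = int b1 - int a1" "u2 = int b2 - int a2"
    "v1 = int c1 - int a1" "v2 = int c2 - int a2"
  have "real_of_int (u1\<^sup>2 + u2\<^sup>2) = real_of_int (v1\<^sup>2 + v2\<^sup>2)"
    using abc(3) unfolding a(1) b(1) c(1) uv
    by (simp add: dist_Pair_Pair dist_real_def power2_commute)
  then have legs: "u1\<^sup>2 + u2\<^sup>2 = v1\<^sup>2 + v2\<^sup>2" by (simp only: of_int_eq_iff)
  have "real_of_int (u1 * v1 + u2 * v2) > 0"
    using abc(4) unfolding a(1) b(1) c(1) uv by simp
  then have ac: "u1 * v1 + u2 * v2 > 0" by (simp only: of_int_0_less_iff)
  have "int ((n - 1)\<^sup>2 + 1) < int k" using k by linarith
  then have tall: "(int n - 1)\<^sup>2 < int k - 1" using a by simp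
  have "v2 = u2 \<and> \<bar>u2\<bar> = int k - 1 \<and> v1 = - u1"
  proof (rule tall_spanning_triangle[OF tall])
    show "\<bar>u2\<bar> = int k - 1 \<or> \<bar>v2\<bar> = int k - 1 \<or> \<bar>u2 - v2\<bar> = int k - 1"
      using rows k a b c unfolding uv by auto
    show "(u1, u2) \<noteq> (v1, v2)" using abc(2) unfolding b(1) c(1) uv by auto
  qed (use a b c legs ac in \<open>auto simp: uv\<close>)
  then have eqs: "c2 = b2" "a2 = 1 \<and> b2 = k \<or> a2 = k \<and> b2 = 1" "int c1 + int b1 = 2 * int a1"
    using a b c unfolding uv by auto
  have bc: "b1 \<noteq> c1" using abc(2) eqs(1) b(1) c(1) by auto
  \<comment> \<open>\<open>b\<close> and \<open>c\<close> are interchangeable, and either may be the left end of the base.\<close>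
  define w where "w = (if b1 < c1 then a1 - b1 else a1 - c1)"
  have wb: "(w, a1) \<in> bases n"
    unfolding mem_bases_iff w_def using eqs(3) bc b c by auto
  have "T = upright_triangle (real b2) (real a2) (w, a1)"
  proof (cases "b1 < c1")
    case True
    then have "real b1 = real a1 - real w" "real c1 = real a1 + real w"
      using eqs(3) unfolding w_def by simp_all
    then show ?thesis unfolding abc(1) a(1) b(1) c(1) upright_triangle_def eqs(1) by simp
  next
    case False
    then have "real c1 = real a1 - real w" "real b1 = real a1 + real w"
      using eqs(3) bc unfolding w_def by simp_all
    then show ?thesis
      unfolding abc(1) a(1) b(1) c(1) upright_triangle_def eqs(1) by (simp add: insert_commute)
  qed
  then show ?thesis using wb eqs(2) by auto
qed

section \<open>Counting the bases\<close>

lemma card_bases: "int (2 * card (bases n)) = \<lfloor>(real n - 1)\<^sup>2 / 2\<rfloor>" if "n \<ge> 1"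
proof -
  define m where "m = (n - 1) div 2"
  \<comment> \<open>Stated for a variable upper bound, so that the induction leaves \<open>n\<close> fixed.\<close>
  have arith: "int (\<Sum>w\<in>{1..j}. n - 2 * w) = int j * (int n - 1 - int j)" if "2 * j \<le> n" for j
    using that by (induction j) (auto simp: algebra_simps)
  have "card (bases n) = (\<Sum>w\<in>{1..m}. n - 2 * w)"
    unfolding bases_def m_def by (simp add: mult_2)
  then have card: "int (2 * card (bases n)) = 2 * (int m * (int n - 1 - int m))"
    using arith[of m] unfolding m_def by (simp only: of_nat_mult of_nat_numeral)
  have "n = 2 * m + 1 \<or> n = 2 * m + 2" using that unfolding m_def by presburger
  then consider "n = 2 * m + 1" | "n = 2 * m + 2" by blast
  then show ?thesis
  proof cases
    case 1
    then have "(real n - 1)\<^sup>2 / 2 = real_of_int (2 * (int m * (int n - 1 - int m)))"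
      by (simp add: power2_eq_square)
    then show ?thesis unfolding card by (simp only: floor_of_int)
  next
    case 2
    then have "(real n - 1)\<^sup>2 / 2 = real_of_int (2 * (int m * (int n - 1 - int m))) + 1 / 2"
      by (simp add: power2_eq_square algebra_simps)
    then show ?thesis unfolding card by linarith
  qed
qed

lemma card_spanning_triangles:
  assumes n: "n \<ge> 2" and k: "k > (n - 1)\<^sup>2 + 1"
  shows "card (spanning_triangles n k) = 2 * card (bases n)"
proof -
  let ?up = "upright_triangle 1 (real k) ` bases n"
    and ?down = "upright_triangle (real k) 1 ` bases n"
  have "(n - 1) * 1 \<le> (n - 1) * (n - 1)" using n by (intro mult_left_mono) auto
  then have nk: "n \<le> k" using k unfolding power2_eq_square by linarith
  then have ne: "1 \<noteq> real k" using n by simp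
  have fin: "finite (bases n)" unfolding bases_def by simp
  have "spanning_triangles n k = ?up \<union> ?down"
  proof
    show "spanning_triangles n k \<subseteq> ?up \<union> ?down" using spanning_triangle_upright[OF k] by blast
    show "?up \<union> ?down \<subseteq> spanning_triangles n k"
      using upright_triangle_spanning[of _ _ n k 1 k] upright_triangle_spanning[of _ _ n k k 1] nk
      by auto
  qed
  then have "card (spanning_triangles n k) = card ?up + card ?down"
    using upright_triangles_disjoint[OF ne] fin by (simp add: card_Un_disjoint)
  then show ?thesis using ne by (simp add: card_image inj_upright_triangle)
qed

theorem theorem3:
  fixes n k :: nat
  assumes "n \<ge> 2"
    and "k > (n - 1)^2 + 1"
  shows "int (acute_isosceles_count n k) =
    2 * int (acute_isosceles_count n (k - 1)) - int (acute_isosceles_count n (k - 2))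
      + \<lfloor>(real n - 1)^2 / 2\<rfloor>"
proof -
  have count: "acute_isosceles_count n j = card (grid_triangles n j)" for j
    unfolding acute_isosceles_count_def grid_triangles_def ..
  have "k \<ge> 2" using assms(2) by linarith
  then obtain j where j: "k = j + 2" using le_Suc_ex[of 2 k] by (auto simp: add.commute)
  have "int (card (grid_triangles n k) + card (grid_triangles n j)) =
      int (2 * card (grid_triangles n (Suc j)) + 2 * card (bases n))"
    using card_grid_triangles_recurrence[of n j] card_spanning_triangles[OF assms] j by simp
  then show ?thesis
    using card_bases[of n] assms(1) unfolding count j by simp
qed

end
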